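(* Let $C > 1$ be a fixed constant. Then for all sufficiently large $s$, \[ r(s, Cs) \ge \left(2^{1 - \frac{1}{2C}}\right)^s. \]
   Context: For positive integers $s,k$, the Ramsey number $r(s,k)$ is the minimum integer $n$ such that every graph on $n$ vertices contains a clique of size $s$ or an independent set of size $k$. Floors and ceilings are omitted (so $Cs$ is understood as an integer rounding of $Cs$). *)

theory Defs
  imports Complex_Main
begin

text \<open>Simple graphs on the vertex set {0..<n}: a symmetric relation E on nat
  (loops are irrelevant, since clique/independence only look at distinct pairs).\<close>

definition is_clique :: "(nat \<Rightarrow> nat \<Rightarrow> bool) \<Rightarrow> nat set \<Rightarrow> bool" where
  "is_clique E S \<longleftrightarrow> (\<forall>x\<in>S. \<forall>y\<in>S. x \<noteq> y \<longrightarrow> E x y)"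

definition is_indep :: "(nat \<Rightarrow> nat \<Rightarrow> bool) \<Rightarrow> nat set \<Rightarrow> bool" where
  "is_indep E S \<longleftrightarrow> (\<forall>x\<in>S. \<forall>y\<in>S. x \<noteq> y \<longrightarrow> \<not> E x y)"

definition ramsey_prop :: "nat \<Rightarrow> nat \<Rightarrow> nat \<Rightarrow> bool" where
  "ramsey_prop s k n \<longleftrightarrow>
     (\<forall>E. (\<forall>x y. E x y = E y x) \<longrightarrow>
        (\<exists>S\<subseteq>{..<n}. card S = s \<and> is_clique E S) \<or>
        (\<exists>S\<subseteq>{..<n}. card S = k \<and> is_indep E S))"

definition ramsey_number :: "nat \<Rightarrow> nat \<Rightarrow> nat" where
  "ramsey_number s k = (LEAST n. ramsey_prop s k n)"

end

theory Submission
  imports Defs "HOL-Library.Ramsey"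
begin

text \<open>Give each vertex i of {0..<n} an independent uniformly random pair (x_i, y_i) of vectors of
  F_2^d, where d = s - 2, and join i < j iff \<open>\<langle>x_i, y_j\<rangle> \<noteq> \<langle>x_i, y_i\<rangle>\<close>. Going through a clique or an
  independent set in increasing order, each vertex confines the later y_j to an affine subspace A.
  In a clique every vertex halves A, because y_i itself is excluded while the next y_j is not; so a
  clique has at most d + 1 vertices. In an independent set y_i survives, so A is halved unless x_i
  is constant on A, which has probability at most 1 / |A|. Hence a k-set is independent with
  probability at most 2^(k + d(d+1)/2 - dk). The union bound over the k-sets therefore
  allows n = 2^(s - s^2/(2k)) vertices, the lower-order losses being absorbed by the k! in
  \<open>n choose k \<le> n^k / k!\<close>.\<close>

subsection \<open>Characters and affine subspaces\<close>

text \<open>The vector space F_2^D is modelled as \<open>Pow D\<close> with symmetric difference as addition;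
  \<open>chi x y\<close> is the sign (-1)^\<open>\<langle>x, y\<rangle>\<close>.\<close>

definition chi :: "'a set \<Rightarrow> 'a set \<Rightarrow> int" where
  "chi x y = (\<Prod>i\<in>x. if i \<in> y then -1 else 1)"

text \<open>Over F_2 the coefficients of an affine combination sum to 1, so an odd number of points
  is added up; closure under sums of three already gives all of these. The empty set counts as
  affine.\<close>

definition affine2 :: "'a set set \<Rightarrow> bool" where
  "affine2 A \<longleftrightarrow> (\<forall>a\<in>A. \<forall>b\<in>A. \<forall>c\<in>A. sym_diff a (sym_diff b c) \<in> A)"

lemma chi_cases: "chi x y = 1 \<or> chi x y = -1"
  unfolding chi_def by (induction x rule: infinite_finite_induct) auto

lemma chi_sym_diff: "chi x (sym_diff y z) = chi x y * chi x z"
  unfolding chi_def prod.distrib[symmetric] by (rule prod.cong) auto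

lemma affine2_Pow: "affine2 (Pow D)"
  unfolding affine2_def by blast

lemma affine2_Collect_chi:
  assumes "affine2 A"
  shows "affine2 {y\<in>A. chi x y = c}"
  unfolding affine2_def
proof (intro ballI CollectI conjI)
  fix a b e assume *: "a \<in> {y\<in>A. chi x y = c}" "b \<in> {y\<in>A. chi x y = c}" "e \<in> {y\<in>A. chi x y = c}"
  then show "sym_diff a (sym_diff b e) \<in> A"
    using assms unfolding affine2_def by blast
  \<comment> \<open>The sign of a sum of three vectors is the product of the three signs, and a sign
    \<open>c\<close> satisfies c * c * c = c.\<close>
  show "chi x (sym_diff a (sym_diff b e)) = c"
    using * chi_cases[of x a] by (auto simp only: chi_sym_diff mem_Collect_eq)
qed

lemma affine2_Collect_chi_neq:
  assumes "affine2 A"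
  shows "affine2 {y\<in>A. chi x y \<noteq> chi x u}"
proof -
  have "{y\<in>A. chi x y \<noteq> chi x u} = {y\<in>A. chi x y = - chi x u}"
    using chi_cases[of x] by (metis minus_minus one_neq_neg_one)
  then show ?thesis
    using affine2_Collect_chi[OF assms] by metis
qed

text \<open>Adding u + v is an involution of \<open>A\<close>; since \<open>chi x\<close> differs at
  \<open>u\<close> and \<open>v\<close>, it flips every sign and so swaps the two parts.\<close>

lemma affine2_card_halves:
  assumes "affine2 A" "finite A" "u \<in> A" "v \<in> A" "chi x v \<noteq> chi x u"
  shows "2 * card {y\<in>A. chi x y = chi x u} = card A"
    and "2 * card {y\<in>A. chi x y \<noteq> chi x u} = card A"
proof -
  let ?E = "{y\<in>A. chi x y = chi x u}" and ?N = "{y\<in>A. chi x y \<noteq> chi x u}"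
  let ?t = "\<lambda>y. sym_diff u (sym_diff v y)"
  have invol: "?t (?t y) = y" for y
    by blast
  have chi_t: "chi x (?t y) = - chi x y" for y
    using assms(5) chi_cases[of x u] chi_cases[of x v] by (auto simp: chi_sym_diff)
  have mem: "?t y \<in> A" if "y \<in> A" for y
    using assms(1,3,4) that unfolding affine2_def by blast
  have neg: "chi x y \<noteq> chi x u \<longleftrightarrow> chi x y = - chi x u" for y
    using chi_cases[of x u] chi_cases[of x y] by auto
  have "bij_betw ?t ?E ?N"
    by (rule bij_betwI[where g = ?t]) (use mem chi_t neg invol in \<open>auto simp del: Un_iff\<close>)
  then have "card ?E = card ?N"
    by (rule bij_betw_same_card)
  moreover have "card A = card (?E \<union> ?N)"
    by (rule arg_cong[where f = card]) blast
  then have "card A = card ?E + card ?N"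
    using assms(2) by (simp add: card_Un_disjoint disjoint_iff)
  ultimately show "2 * card ?E = card A" "2 * card ?N = card A"
    by simp_all
qed

text \<open>The sum over all \<open>x\<close> factors over the coordinates, and a coordinate where
  \<open>y\<close> and \<open>z\<close> differ contributes the factor -1 + 1 = 0.\<close>

lemma sum_chi_orthogonal:
  assumes "finite D" "y \<subseteq> D" "z \<subseteq> D"
  shows "(\<Sum>x\<in>Pow D. chi x y * chi x z) = (if y = z then 2 ^ card D else 0)"
proof -
  have "(\<Sum>x\<in>Pow D. chi x y * chi x z) = (\<Sum>x\<in>Pow D. chi x (sym_diff y z))"
    by (simp add: chi_sym_diff)
  also have "\<dots> = (\<Prod>i\<in>D. (if i \<in> sym_diff y z then -1 else 1) + 1)"
    unfolding chi_def using prod_add[OF assms(1), of "\<lambda>i. if i \<in> sym_diff y z then -1 else 1" "\<lambda>_. 1::int"]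
    by simp
  also have "\<dots> = (if y = z then 2 ^ card D else 0)"
  proof (cases "y = z")
    case False
    then obtain i where "i \<in> D" "i \<in> sym_diff y z"
      using assms(2,3) by blast
    then show ?thesis
      using False assms(1) by (auto intro!: prod_zero)
  qed simp
  finally show ?thesis .
qed

text \<open>Parseval's identity for the indicator function of A: every constant character contributes
  \<open>(card A)\<^sup>2\<close> to a total of \<open>2 ^ card D * card A\<close>.\<close>

lemma card_constant_chi:
  assumes "finite D" "A \<subseteq> Pow D" "A \<noteq> {}"
  shows "card {x\<in>Pow D. \<forall>u\<in>A. \<forall>v\<in>A. chi x u = chi x v} * card A \<le> 2 ^ card D"
proof -
  define K where "K = {x\<in>Pow D. \<forall>u\<in>A. \<forall>v\<in>A. chi x u = chi x v}"
  have finA: "finite A"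
    using assms finite_subset by auto
  obtain u where u: "u \<in> A"
    using assms(3) by blast
  have "(\<Sum>y\<in>A. chi x y)\<^sup>2 = (int (card A))\<^sup>2" if "x \<in> K" for x
  proof -
    have "(\<Sum>y\<in>A. chi x y) = (\<Sum>y\<in>A. chi x u)"
      using that u unfolding K_def by (intro sum.cong refl) blast
    then show ?thesis
      using chi_cases[of x u] by (elim disjE) simp_all
  qed
  then have "int (card K) * (int (card A))\<^sup>2 = (\<Sum>x\<in>K. (\<Sum>y\<in>A. chi x y)\<^sup>2)"
    by simp
  also have "\<dots> \<le> (\<Sum>x\<in>Pow D. (\<Sum>y\<in>A. chi x y)\<^sup>2)"
    using assms(1) by (intro sum_mono2) (auto simp only: K_def finite_Pow_iff mem_Collect_eq zero_le_power2)
  also have "\<dots> = (\<Sum>x\<in>Pow D. \<Sum>y\<in>A. \<Sum>z\<in>A. chi x y * chi x z)"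
    by (simp add: power2_eq_square sum_product)
  also have "\<dots> = (\<Sum>y\<in>A. \<Sum>z\<in>A. \<Sum>x\<in>Pow D. chi x y * chi x z)"
    by (subst sum.swap, rule sum.cong[OF refl], rule sum.swap)
  also have "\<dots> = (\<Sum>y\<in>A. \<Sum>z\<in>A. if y = z then 2 ^ card D else 0)"
    using assms by (intro sum.cong refl sum_chi_orthogonal) auto
  also have "\<dots> = int (card A) * 2 ^ card D"
    using finA by simp
  finally have "int (card A) * int (card K * card A) \<le> int (card A) * int (2 ^ card D)"
    by (simp add: power2_eq_square mult_ac)
  then show ?thesis
    unfolding K_def[symmetric] using finA u
    by (metis card_gt_0_iff empty_iff mult_le_cancel_left_pos of_nat_0_less_iff of_nat_le_iff)
qed

subsection \<open>Cliques and independent sets\<close>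

text \<open>Induction removing the smallest vertex: \<open>A\<close> is the subspace left for the
  later second vectors, and each vertex that has a successor halves it. The last vertex costs no
  halving, hence the extra 1.\<close>

lemma clique_card_le:
  fixes z :: "nat \<Rightarrow> 'a set \<times> 'a set"
  assumes "finite S" "S \<noteq> {}" "finite A" "affine2 A" "card A = 2 ^ a" "\<forall>i\<in>S. snd (z i) \<in> A"
    and "\<And>i j. i \<in> S \<Longrightarrow> j \<in> S \<Longrightarrow> i < j \<Longrightarrow> chi (fst (z i)) (snd (z j)) \<noteq> chi (fst (z i)) (snd (z i))"
  shows "card S \<le> a + 1"
  using assms
proof (induction S arbitrary: A a rule: finite_linorder_min_induct)
  case (insert m S)
  show ?case
  proof (cases "S = {}")
    case False
    then obtain j where j: "j \<in> S"
      by blast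
    let ?A = "{y\<in>A. chi (fst (z m)) y \<noteq> chi (fst (z m)) (snd (z m))}"
    have "2 * card ?A = 2 ^ a"
      using affine2_card_halves(2)[of A "snd (z m)" "snd (z j)" "fst (z m)"] insert.prems insert.hyps j
      by auto
    \<comment> \<open>The power \<open>2 ^ a\<close> is twice a cardinality, hence even, so
      \<open>a\<close> is positive.\<close>
    moreover from this obtain b where b: "a = Suc b"
      by (cases a) (auto dest: arg_cong[where f = even])
    ultimately have "card ?A = 2 ^ b"
      by simp
    then have "card S \<le> b + 1"
      using insert.prems insert.hyps False
      by (intro insert.IH[where A = ?A] affine2_Collect_chi_neq) auto
    then show ?thesis
      using b insert.hyps by (subst card_insert_disjoint) auto
  qed simp
qed simp

text \<open>The labellings that make \<open>S\<close> independent. The second vectors are confined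
  to a variable set \<open>A\<close> so that an induction can shrink it.\<close>

definition indep_maps :: "'a set \<Rightarrow> 'a set set \<Rightarrow> nat set \<Rightarrow> (nat \<Rightarrow> 'a set \<times> 'a set) set" where
  "indep_maps D A S = {z \<in> S \<rightarrow>\<^sub>E Pow D \<times> A.
     \<forall>i\<in>S. \<forall>j\<in>S. i < j \<longrightarrow> chi (fst (z i)) (snd (z j)) = chi (fst (z i)) (snd (z i))}"

lemma finite_indep_maps:
  assumes "finite D" "finite A" "finite S"
  shows "finite (indep_maps D A S)"
  by (rule finite_subset[OF _ finite_PiE[of S "\<lambda>_. Pow D \<times> A"]])
    (use assms in \<open>auto simp: indep_maps_def\<close>)

text \<open>Revealing the label \<open>p\<close> of the smallest vertex first leaves the same
  problem on \<open>S\<close> with a smaller subspace.\<close>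

lemma indep_maps_insert_Min:
  assumes "\<forall>i\<in>S. m < i"
  shows "indep_maps D A (insert m S) \<subseteq>
    (\<Union>p\<in>Pow D \<times> A. (\<lambda>g. g(m := p)) ` indep_maps D {y\<in>A. chi (fst p) y = chi (fst p) (snd p)} S)"
proof
  fix z assume z: "z \<in> indep_maps D A (insert m S)"
  \<comment> \<open>Resetting \<open>m\<close> makes the function extensional on \<open>S\<close>
    alone.\<close>
  let ?g = "z(m := undefined)"
  have PiE: "z \<in> insert m S \<rightarrow>\<^sub>E Pow D \<times> A"
    using z unfolding indep_maps_def by blast
  have eq: "chi (fst (z i)) (snd (z j)) = chi (fst (z i)) (snd (z i))"
    if "i \<in> insert m S" "j \<in> insert m S" "i < j" for i j
    using z that unfolding indep_maps_def by blast
  have g: "?g i = z i" if "i \<in> S" for i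
    using assms that by auto
  have "z m \<in> Pow D \<times> A"
    using PiE by blast
  moreover have "?g \<in> indep_maps D {y\<in>A. chi (fst (z m)) y = chi (fst (z m)) (snd (z m))} S"
    unfolding indep_maps_def
  proof (intro CollectI conjI PiE_I ballI impI)
    fix i assume i: "i \<in> S"
    have "z i \<in> Pow D \<times> A"
      using PiE i by blast
    then show "?g i \<in> Pow D \<times> {y\<in>A. chi (fst (z m)) y = chi (fst (z m)) (snd (z m))}"
      unfolding g[OF i] using eq[of m i] assms i by (simp add: mem_Times_iff)
  next
    fix i assume "i \<notin> S"
    then show "?g i = undefined"
      using PiE by (cases "i = m") (auto simp: PiE_iff extensional_def)
  next
    fix i j assume "i \<in> S" "j \<in> S" "i < j"
    then show "chi (fst (?g i)) (snd (?g j)) = chi (fst (?g i)) (snd (?g i))"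
      using eq[of i j] by (simp only: g insert_iff simp_thms)
  qed
  moreover have "z = ?g(m := z m)"
    by simp
  ultimately show "z \<in> (\<Union>p\<in>Pow D \<times> A. (\<lambda>g. g(m := p)) ` indep_maps D {y\<in>A. chi (fst p) y = chi (fst p) (snd p)} S)"
    by (intro UN_I[where a = "z m"] image_eqI[where x = ?g])
qed

text \<open>Split on the first vector \<open>x\<close> of the smallest vertex. If
  \<open>chi x\<close> is constant on \<open>A\<close>, there are at most 2^d / |A| such
  \<open>x\<close>, hence at most 2^d labels, and \<open>A\<close> stays. Otherwise there are at
  most 2^d * 2^a labels, and halving \<open>A\<close> lowers the inductive bound by the factor 2^a.
  Both cases give the same total, so each vertex costs 2 * 2^d.\<close>

lemma card_indep_maps_le:
  assumes "finite S" "finite D" "A \<subseteq> Pow D" "affine2 A" "card A = 2 ^ a"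
  shows "card (indep_maps D A S) \<le> 2 ^ (card D * card S + card S + \<Sum>{..a})"
  using assms
proof (induction S arbitrary: A a rule: finite_linorder_min_induct)
  case empty
  then show ?case
    by (simp add: indep_maps_def)
next
  case (insert m S)
  let ?d = "card D" and ?k = "card S"
  let ?A = "\<lambda>p. {y\<in>A. chi (fst p) y = chi (fst p) (snd p)}"
  define K where "K = {x\<in>Pow D. \<forall>u\<in>A. \<forall>v\<in>A. chi x u = chi x v}"
  let ?M = "2 ^ (?d * ?k + ?k) :: nat"
  have finA: "finite A" and neA: "A \<noteq> {}"
    using insert.prems finite_subset by auto
  have const: "card (indep_maps D (?A p) S) \<le> ?M * 2 ^ \<Sum>{..a}" if "p \<in> K \<times> A" for p
  proof -
    have "fst p \<in> K" "snd p \<in> A"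
      using that by (auto simp only: mem_Times_iff)
    then have "?A p = A"
      unfolding K_def by blast
    then show ?thesis
      using insert.IH[OF insert.prems] by (simp add: power_add)
  qed
  \<comment> \<open>Passing from \<open>a\<close> to \<open>b = a - 1\<close> removes exactly the
    term \<open>a\<close> from the exponent sum.\<close>
  have halve: "2 ^ a * card (indep_maps D (?A p) S) \<le> ?M * 2 ^ \<Sum>{..a}"
    if p: "p \<in> (Pow D - K) \<times> A" for p
  proof -
    obtain u w where "u \<in> A" "w \<in> A" "chi (fst p) u \<noteq> chi (fst p) w"
      using p unfolding K_def mem_Times_iff by blast
    then obtain v where v: "v \<in> A" "chi (fst p) v \<noteq> chi (fst p) (snd p)"
      by metis
    have "2 * card (?A p) = 2 ^ a"
      using affine2_card_halves(1)[OF insert.prems(3) finA _ v] that insert.prems(4) by auto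
    moreover from this obtain b where b: "a = Suc b"
      by (cases a) (auto dest: arg_cong[where f = even])
    ultimately have "card (?A p) = 2 ^ b"
      by simp
    then have "card (indep_maps D (?A p) S) \<le> ?M * 2 ^ \<Sum>{..b}"
      unfolding power_add[symmetric] using insert.prems
      by (intro insert.IH affine2_Collect_chi) auto
    then have "2 ^ a * card (indep_maps D (?A p) S) \<le> 2 ^ a * (?M * 2 ^ \<Sum>{..b})"
      by (rule mult_le_mono2)
    also have "\<dots> = ?M * 2 ^ \<Sum>{..a}"
      by (simp add: b power_add)
    finally show ?thesis .
  qed
  have finD: "finite (Pow D)" and finPA: "finite (Pow D \<times> A)"
    using insert.prems finA by auto
  have finK: "finite K"
    using finite_subset[OF _ finD, of K] unfolding K_def by blast
  have "card (indep_maps D A (insert m S)) \<le>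
      card (\<Union>p\<in>Pow D \<times> A. (\<lambda>g. g(m := p)) ` indep_maps D (?A p) S)"
    using insert.hyps insert.prems finPA finA
    by (intro card_mono indep_maps_insert_Min finite_UN_I finite_imageI finite_indep_maps) auto
  also have "\<dots> \<le> (\<Sum>p\<in>Pow D \<times> A. card (indep_maps D (?A p) S))"
    using insert.hyps insert.prems finA finPA
    by (intro order.trans[OF card_UN_le] sum_mono card_image_le finite_indep_maps) auto
  also have "\<dots> = (\<Sum>p\<in>K \<times> A \<union> (Pow D - K) \<times> A. card (indep_maps D (?A p) S))"
    unfolding K_def by (intro sum.cong refl) blast
  also have "\<dots> = (\<Sum>p\<in>K \<times> A. card (indep_maps D (?A p) S)) +
      (\<Sum>p\<in>(Pow D - K) \<times> A. card (indep_maps D (?A p) S))"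
    using finA finK finD by (intro sum.union_disjoint finite_cartesian_product) auto
  also have "\<dots> \<le> 2 ^ ?d * (?M * 2 ^ \<Sum>{..a}) + 2 ^ ?d * (?M * 2 ^ \<Sum>{..a})"
  proof (rule add_mono)
    have "(\<Sum>p\<in>K \<times> A. card (indep_maps D (?A p) S)) \<le> card (K \<times> A) * (?M * 2 ^ \<Sum>{..a})"
      using sum_bounded_above[of "K \<times> A", OF const] by simp
    also have "\<dots> \<le> 2 ^ ?d * (?M * 2 ^ \<Sum>{..a})"
      unfolding card_cartesian_product
      using card_constant_chi[OF insert.prems(1,2) neA, folded K_def] by (rule mult_le_mono1)
    finally show "(\<Sum>p\<in>K \<times> A. card (indep_maps D (?A p) S)) \<le> 2 ^ ?d * (?M * 2 ^ \<Sum>{..a})" .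
    \<comment> \<open>The factor \<open>2 ^ a\<close> carried along here cancels against the choices
      of the second vector in \<open>A\<close>.\<close>
    have "2 ^ a * (\<Sum>p\<in>(Pow D - K) \<times> A. card (indep_maps D (?A p) S))
        \<le> card ((Pow D - K) \<times> A) * (?M * 2 ^ \<Sum>{..a})"
      unfolding sum_distrib_left
      using sum_bounded_above[of "(Pow D - K) \<times> A", OF halve] by simp
    also have "\<dots> \<le> (2 ^ ?d * 2 ^ a) * (?M * 2 ^ \<Sum>{..a})"
    proof (rule mult_le_mono1)
      have "card (Pow D - K) \<le> 2 ^ ?d"
        using card_mono[OF finD, of "Pow D - K"] insert.prems(1) by (simp add: card_Pow)
      then show "card ((Pow D - K) \<times> A) \<le> 2 ^ ?d * 2 ^ a"
        unfolding card_cartesian_product insert.prems(4) by (rule mult_le_mono1)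
    qed
    finally show "(\<Sum>p\<in>(Pow D - K) \<times> A. card (indep_maps D (?A p) S)) \<le> 2 ^ ?d * (?M * 2 ^ \<Sum>{..a})"
      by simp
  qed
  also have "\<dots> = 2 ^ (?d * card (insert m S) + card (insert m S) + \<Sum>{..a})"
  proof -
    have "card (insert m S) = ?k + 1"
      using insert.hyps by (subst card_insert_disjoint) auto
    then show ?thesis
      by (simp add: power_add)
  qed
  finally show ?case .
qed

subsection \<open>The random construction\<close>

text \<open>A labelling is determined by its restrictions to \<open>S\<close> and to
  \<open>V - S\<close>; only the former is constrained by \<open>B\<close>.\<close>

lemma card_PiE_restrict_le:
  assumes "finite V" "S \<subseteq> V" "finite Z" "finite B"
  shows "card {z \<in> V \<rightarrow>\<^sub>E Z. restrict z S \<in> B} \<le> card B * card Z ^ (card V - card S)"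
proof -
  let ?f = "\<lambda>z. (restrict z S, restrict z (V - S))"
  have "inj_on ?f {z \<in> V \<rightarrow>\<^sub>E Z. restrict z S \<in> B}"
  proof (rule inj_onI)
    fix z w assume zw: "z \<in> {z \<in> V \<rightarrow>\<^sub>E Z. restrict z S \<in> B}" "w \<in> {z \<in> V \<rightarrow>\<^sub>E Z. restrict z S \<in> B}"
      and eq: "?f z = ?f w"
    have "z i = w i" if "i \<in> V" for i
      using eq that by (metis DiffI prod.inject restrict_apply')
    then show "z = w"
      using zw by (intro PiE_ext[of z V "\<lambda>_. Z" w]) auto
  qed
  moreover have "?f ` {z \<in> V \<rightarrow>\<^sub>E Z. restrict z S \<in> B} \<subseteq> B \<times> ((V - S) \<rightarrow>\<^sub>E Z)"
    by auto
  moreover have "finite (B \<times> ((V - S) \<rightarrow>\<^sub>E Z))"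
    using assms by (intro finite_cartesian_product finite_PiE) auto
  ultimately have "card {z \<in> V \<rightarrow>\<^sub>E Z. restrict z S \<in> B} \<le> card (B \<times> ((V - S) \<rightarrow>\<^sub>E Z))"
    by (rule card_inj_on_le)
  also have "\<dots> = card B * card Z ^ (card V - card S)"
    using assms by (simp add: card_cartesian_product card_PiE card_Diff_subset finite_subset)
  finally show ?thesis .
qed

text \<open>Cliques are short for every labelling, so only independent sets enter the union bound;
  \<open>less\<close> makes the bound on their expected number smaller than 1. Probabilities are
  replaced by counts of labellings.\<close>

lemma not_ramsey_prop:
  assumes "d + 2 \<le> s" and less: "(n choose k) * 2 ^ (k + \<Sum>{..d}) < 2 ^ (d * k)"
  shows "\<not> ramsey_prop s k n"
proof -
  let ?D = "{..<d}" and ?V = "{..<n}"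
  let ?Z = "Pow ?D \<times> Pow ?D"
  let ?B = "\<lambda>S. {z \<in> ?V \<rightarrow>\<^sub>E ?Z. restrict z S \<in> indep_maps ?D (Pow ?D) S}"
  let ?T = "{S. S \<subseteq> ?V \<and> card S = k}"
  have cardZ: "card ?Z = 2 ^ d * 2 ^ d"
    by (simp add: card_cartesian_product card_Pow)
  have cardT: "card ?T = n choose k"
    using n_subsets[of ?V k] by simp
  \<comment> \<open>Multiplying by \<open>card ?Z ^ k\<close> turns the exponent
    \<open>n - k\<close> into \<open>n\<close>, which no longer involves a truncated
    subtraction.\<close>
  have cardB: "card (?B S) * card ?Z ^ k \<le> 2 ^ (d * k + k + \<Sum>{..d}) * card ?Z ^ n" if "S \<in> ?T" for S
  proof -
    have S: "S \<subseteq> ?V" "card S = k" "finite S" "k \<le> n"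
      using that finite_subset[of S ?V] card_mono[of ?V S] by auto
    have "card (?B S) \<le> card (indep_maps ?D (Pow ?D) S) * card ?Z ^ (n - k)"
      using card_PiE_restrict_le[of ?V S ?Z "indep_maps ?D (Pow ?D) S"] S
      by (simp add: finite_indep_maps)
    also have "\<dots> \<le> 2 ^ (d * k + k + \<Sum>{..d}) * card ?Z ^ (n - k)"
      using card_indep_maps_le[of S ?D "Pow ?D" d] S by (simp add: affine2_Pow card_Pow)
    finally have "card (?B S) * card ?Z ^ k \<le> 2 ^ (d * k + k + \<Sum>{..d}) * card ?Z ^ (n - k) * card ?Z ^ k"
      by (rule mult_le_mono1)
    then show ?thesis
      using S(4) by (simp add: mult.assoc flip: power_add)
  qed
  have "card (\<Union>S\<in>?T. ?B S) * card ?Z ^ k \<le> (\<Sum>S\<in>?T. card (?B S)) * card ?Z ^ k"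
    by (intro mult_le_mono1 card_UN_le) simp
  also have "\<dots> \<le> (n choose k) * (2 ^ (d * k + k + \<Sum>{..d}) * card ?Z ^ n)"
    unfolding sum_distrib_right using sum_bounded_above[of ?T, OF cardB] cardT by simp
  also have "\<dots> = ((n choose k) * 2 ^ (k + \<Sum>{..d})) * (2 ^ (d * k) * card ?Z ^ n)"
    by (simp add: power_add)
  also have "\<dots> < 2 ^ (d * k) * (2 ^ (d * k) * card ?Z ^ n)"
    using less cardZ by (intro mult_strict_right_mono) auto
  also have "\<dots> = card (?V \<rightarrow>\<^sub>E ?Z) * card ?Z ^ k"
    by (simp add: card_PiE cardZ power_mult power_mult_distrib)
  finally have "card (\<Union>S\<in>?T. ?B S) < card (?V \<rightarrow>\<^sub>E ?Z)"
    by (rule mult_right_less_imp_less) simp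
  then have "\<not> (?V \<rightarrow>\<^sub>E ?Z) \<subseteq> (\<Union>S\<in>?T. ?B S)"
    using card_mono[of "\<Union>S\<in>?T. ?B S" "?V \<rightarrow>\<^sub>E ?Z"] by (auto simp: finite_PiE)
  then obtain z where z: "z \<in> ?V \<rightarrow>\<^sub>E ?Z" and notB: "\<And>S. S \<in> ?T \<Longrightarrow> z \<notin> ?B S"
    by blast
  let ?e = "\<lambda>i j. chi (fst (z i)) (snd (z j)) \<noteq> chi (fst (z i)) (snd (z i))"
  \<comment> \<open>The adjacency rule depends on the order of the endpoints; \<open>min\<close> and
    \<open>max\<close> make it symmetric.\<close>
  define E where "E = (\<lambda>i j. ?e (min i j) (max i j))"
  have "\<forall>x y. E x y = E y x"
    unfolding E_def by (simp add: min.commute max.commute)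
  moreover have False if S: "S \<subseteq> ?V" "card S = s" "is_clique E S" for S
  proof -
    have edge: "?e i j" if "i \<in> S" "j \<in> S" "i < j" for i j
      using S(3)[unfolded E_def is_clique_def, rule_format, OF that(1,2)] that(3) by simp
    have "card S \<le> d + 1"
      using S z assms(1) finite_subset[OF S(1)]
      by (intro clique_card_le[where A = "Pow ?D" and z = z] edge affine2_Pow)
        (auto simp: card_Pow PiE_iff mem_Times_iff)
    then show False
      using S(2) assms(1) by simp
  qed
  moreover have False if S: "S \<subseteq> ?V" "card S = k" "is_indep E S" for S
  proof -
    have "\<not> ?e i j" if "i \<in> S" "j \<in> S" "i < j" for i j
      using S(3)[unfolded E_def is_indep_def, rule_format, OF that(1,2)] that(3) by simp
    then have "restrict z S \<in> indep_maps ?D (Pow ?D) S"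
      using z S(1) unfolding indep_maps_def by (intro CollectI conjI restrict_PiE_iff[THEN iffD2]) auto
    then have "z \<in> ?B S"
      using z by (simp only: mem_Collect_eq simp_thms)
    then show False
      using notB[of S] S(1,2) by blast
  qed
  ultimately show ?thesis
    unfolding ramsey_prop_def by blast
qed

text \<open>Ramsey's theorem guarantees that some \<open>n\<close> qualifies, so the
  \<open>LEAST\<close> in the definition is attained.\<close>

lemma ramsey_prop_ramsey_number: "ramsey_prop s k (ramsey_number s k)"
proof -
  obtain r where r: "\<And>(V::nat set) E. finite V \<Longrightarrow> card V \<ge> r \<Longrightarrow>
      \<exists>R\<subseteq>V. card R = s \<and> clique R E \<or> card R = k \<and> indep R E"
    using ramsey2[of s k] by metis
  have "ramsey_prop s k r"
    unfolding ramsey_prop_def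
  proof (intro allI impI)
    fix E :: "nat \<Rightarrow> nat \<Rightarrow> bool" assume sym: "\<forall>x y. E x y = E y x"
    have edge: "{v, w} \<in> {{x, y} |x y. E x y} \<longleftrightarrow> E v w" for v w
      using sym by (auto simp: doubleton_eq_iff)
    obtain R where "R \<subseteq> {..<r}" "card R = s \<and> clique R {{x, y} |x y. E x y} \<or>
        card R = k \<and> indep R {{x, y} |x y. E x y}"
      using r[of "{..<r}" "{{x, y} |x y. E x y}"] by auto
    then show "(\<exists>S\<subseteq>{..<r}. card S = s \<and> is_clique E S) \<or> (\<exists>S\<subseteq>{..<r}. card S = k \<and> is_indep E S)"
      unfolding clique_def indep_def is_clique_def is_indep_def edge by blast
  qed
  then show ?thesis
    unfolding ramsey_number_def by (rule LeastI)
qed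

section \<open>Asymptotic estimates\<close>

lemma eventually_power_less_fact: "\<forall>\<^sub>F n in sequentially. c ^ n < (fact n :: real)"
proof -
  have "(\<lambda>n. inverse (fact n) * c ^ n) \<longlonglongrightarrow> 0"
    by (rule summable_LIMSEQ_zero[OF summable_exp])
  then have "\<forall>\<^sub>F n in sequentially. inverse (fact n) * c ^ n < 1"
    by (rule order_tendstoD) simp
  then show ?thesis
    by eventually_elim (simp add: field_simps)
qed

text \<open>By \<open>n choose k \<le> n^k / k!\<close>, it suffices that the exponents of 2 exceed
  the target by at most 4k, a factor \<open>16 ^ k\<close> that \<open>fact k\<close> beats.\<close>

lemma choose_less_two_power:
  fixes C :: real
  assumes C: "C > 1" and s: "s \<ge> 2" and k: "k = nat \<lfloor>C * real s\<rfloor>" and fact: "16 ^ k < (fact k :: real)"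
    and n: "real n < (2 powr (1 - 1 / (2 * C))) powr real s"
  shows "(n choose k) * 2 ^ (k + \<Sum>{..s - 2}) < 2 ^ ((s - 2) * k)"
proof -
  have kC: "real k \<ge> C * real s - 1" and ks: "s \<le> k"
  proof -
    have "real s \<le> C * real s"
      using C mult_right_mono[of 1 C "real s"] by simp
    then show "s \<le> k"
      unfolding k by (rule le_nat_floor)
    have "0 \<le> \<lfloor>C * real s\<rfloor>"
      using C by simp
    then have "real k = of_int \<lfloor>C * real s\<rfloor>"
      unfolding k by simp
    then show "real k \<ge> C * real s - 1"
      by linarith
  qed
  have T: "real (\<Sum>{..s - 2}) \<le> real s ^ 2 / 2"
  proof -
    have "2 * \<Sum>{..m} = m * (m + 1)" for m :: nat
      by (induction m) auto
    then have "2 * \<Sum>{..s - 2} = (s - 2) * (s - 2 + 1)"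
      by blast
    also have "\<dots> \<le> s * s"
      using s by (intro mult_le_mono) auto
    finally have "2 * real (\<Sum>{..s - 2}) \<le> real s * real s"
      by (metis of_nat_le_iff of_nat_mult of_nat_numeral)
    then show ?thesis
      by (simp add: power2_eq_square)
  qed
  \<comment> \<open>As k is about Cs, sk/(2C) is at least s^2/2 - s, which cancels the s^2/2 from
    the sum. The remainder s + k is at most 2k, and replacing \<open>s\<close> by
    \<open>s - 2\<close> costs another 2k.\<close>
  have exponent: "(1 - 1 / (2 * C)) * real s * real k + real k + real (\<Sum>{..s - 2})
      \<le> (real s - 2) * real k + 4 * real k"
  proof -
    have "real s * real k / (2 * C) \<ge> real s * (C * real s - 1) / (2 * C)"
      using kC C by (intro divide_right_mono mult_left_mono) auto
    moreover have "real s * (C * real s - 1) / (2 * C) = real s ^ 2 / 2 - real s / (2 * C)"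
      using C by (simp add: field_simps power2_eq_square)
    moreover have "real s / (2 * C) \<le> real s / 1"
      using C by (intro divide_left_mono) auto
    moreover have "(1 - 1 / (2 * C)) * real s * real k = real s * real k - real s * real k / (2 * C)"
      by (simp add: left_diff_distrib)
    moreover have "(real s - 2) * real k = real s * real k - 2 * real k"
      by (rule left_diff_distrib)
    moreover have "real s \<le> real k"
      using ks by simp
    ultimately show ?thesis
      using T by linarith
  qed
  have "real (n choose k) * fact k \<le> real n ^ k"
    using binomial_fact_pow[of n k] by (metis of_nat_fact of_nat_le_iff of_nat_mult of_nat_power)
  also have "\<dots> \<le> ((2 powr (1 - 1 / (2 * C))) powr real s) ^ k"
    using n by (intro power_mono) auto
  also have "\<dots> = 2 powr ((1 - 1 / (2 * C)) * real s * real k)"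
    by (simp add: powr_powr flip: powr_realpow)
  finally have "real (n choose k) * fact k * 2 ^ (k + \<Sum>{..s - 2})
      \<le> 2 powr ((1 - 1 / (2 * C)) * real s * real k) * 2 ^ (k + \<Sum>{..s - 2})"
    by (intro mult_right_mono) auto
  also have "\<dots> = 2 powr ((1 - 1 / (2 * C)) * real s * real k + real k + real (\<Sum>{..s - 2}))"
    by (simp add: powr_add powr_realpow power_add del: of_nat_sum)
  also have "\<dots> \<le> 2 powr ((real s - 2) * real k + 4 * real k)"
    using exponent by (intro powr_mono) auto
  also have "\<dots> = 2 powr real ((s - 2) * k) * 2 powr real (4 * k)"
    using s by (simp add: powr_add of_nat_diff)
  also have "\<dots> = 2 ^ ((s - 2) * k) * 16 ^ k"
    by (simp only: powr_realpow zero_less_numeral power_mult) simp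
  also have "\<dots> < 2 ^ ((s - 2) * k) * fact k"
    using fact by simp
  finally have "(real (n choose k) * 2 ^ (k + \<Sum>{..s - 2})) * fact k < 2 ^ ((s - 2) * k) * fact k"
    by (simp add: mult_ac)
  then have "real (n choose k) * 2 ^ (k + \<Sum>{..s - 2}) < 2 ^ ((s - 2) * k)"
    by simp
  then have "real ((n choose k) * 2 ^ (k + \<Sum>{..s - 2})) < real (2 ^ ((s - 2) * k))"
    by simp
  then show ?thesis
    by (simp only: of_nat_less_iff)
qed

theorem theorem1p4:
  fixes C :: real
  assumes "C > 1"
  shows "\<forall>\<^sub>F s in sequentially.
           real (ramsey_number s (nat \<lfloor>C * real s\<rfloor>)) \<ge> (2 powr (1 - 1 / (2 * C))) powr real s"
proof -
  \<comment> \<open>Since C > 1, k is at least s and tends to infinity, so the factorial estimate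
    holds at k for all large s.\<close>
  have "filterlim (\<lambda>s. nat \<lfloor>C * real s\<rfloor>) sequentially sequentially"
  proof (rule filterlim_at_top_mono[OF filterlim_ident])
    show "\<forall>\<^sub>F s in sequentially. s \<le> nat \<lfloor>C * real s\<rfloor>"
      using assms mult_right_mono[of 1 C "real s" for s]
      by (intro always_eventually allI le_nat_floor) simp
  qed
  then have "\<forall>\<^sub>F s in sequentially. 16 ^ nat \<lfloor>C * real s\<rfloor> < (fact (nat \<lfloor>C * real s\<rfloor>) :: real)"
    using eventually_power_less_fact eventually_compose_filterlim by blast
  from this eventually_ge_at_top[of 2] show ?thesis
  proof eventually_elim
    case (elim s)
    let ?k = "nat \<lfloor>C * real s\<rfloor>"
    show ?case
    \<comment> \<open>The construction is applied with n equal to the Ramsey number itself: were it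
      below the bound, it would lack its defining property.\<close>
    proof (rule ccontr)
      assume "\<not> ?case"
      then have "(ramsey_number s ?k choose ?k) * 2 ^ (?k + \<Sum>{..s - 2}) < 2 ^ ((s - 2) * ?k)"
        using assms elim by (intro choose_less_two_power[OF _ _ refl]) auto
      then have "\<not> ramsey_prop s ?k (ramsey_number s ?k)"
        using elim by (intro not_ramsey_prop) auto
      then show False
        using ramsey_prop_ramsey_number by blast
    qed
  qed
qed

end
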